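(* Let $n,m\in\{1,2,\dots\}$, $A\in\mathbb R^{n\times n}$, $B\in\mathbb R^{n\times m}\setminus\{0\}$ and $x_0\in\mathbb R^n\setminus\{0\}$. Assume that the time optimal control problem $(\mathcal{TP})_{x_0}$ has an admissible control, and let $T^*_{x_0}$ and $u^*_{x_0}$ be its optimal time and optimal control. Then the dynamic behaviour of the optimal control $u^*_{x_0}$ has one and only one of the following four possibilities: ($\mathbf A_1$) it stays in one direction on $\partial B_1(0)$ over $(0,T^*_{x_0})$, i.e. there is $v\in\partial B_1(0)$ such that $u^*_{x_0}(t)=v$ for all $t\in(0,T^*_{x_0})$; ($\mathbf A_2$) it continuously moves on $\partial B_1(0)$ (over $(0,T^*_{x_0})$), and in any (nondegenerate) subinterval of $(0,T^*_{x_0})$ it never stays constantly in one direction; ($\mathbf A_3$) it is (over $(0,T^*_{x_0})$) a non-constant-valued step function taking only two values on $\partial B_1(0)$, which have opposite directions (i.e. the values are $v$ and $-v$ for some $v\in\partial B_1(0)$); ($\mathbf A_4$) it is (over $(0,T^*_{x_0})$) a non-constant-valued piecewise continuous function, and in any (nondegenerate) subinterval of $(0,T^*_{x_0})$ it never stays constantly in one direction.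
   Context: Notation: $\mathbb R^+=(0,+\infty)$; $B_1(0)$ is the closed unit ball of $\mathbb R^m$ (Euclidean norm) centered at $0$ and $\partial B_1(0)$ its boundary. $\mathcal{PC}(\mathbb R^+;E)$ (with $\emptyset\ne E\subset\mathbb R^m$) is the space of all piecewise continuous and left continuous functions $\mathbb R^+\to E$ with finitely many discontinuities. Control system: for $u\in\mathcal{PC}(\mathbb R^+;\mathbb R^m)$, $x(\cdot;x_0,u)$ is the solution of $x'(t)=Ax(t)+Bu(t)$, $t\ge0$, $x(0)=x_0$. Problem $(\mathcal{TP})_{x_0}$: $T^*_{x_0}=\inf\{\hat t>0:\exists\, u\in\mathcal{PC}(\mathbb R^+;B_1(0))\text{ s.t. }x(\hat t;x_0,u)=0\}$ is the optimal time. A control $u\in\mathcal{PC}(\mathbb R^+;B_1(0))$ is admissible if $x(\hat t;x_0,u)=0$ for some $\hat t>0$. A control $u^*_{x_0}\in\mathcal{PC}(\mathbb R^+;B_1(0))$ is an optimal control if $x(T^*_{x_0};x_0,u^*_{x_0})=0$ and $u^*_{x_0}(t)=0$ for all $t>T^*_{x_0}$. When an admissible control exists, $0<T^*_{x_0}<+\infty$ and there is exactly one optimal control, denoted $u^*_{x_0}$.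
   Formalization: In (A4), "piecewise continuous" is taken to mean having at least one discontinuity in (0,T* ); otherwise every control of type (A2) would also be of type (A4), and "one and only one" would fail. *)

theory Defs
  imports "HOL-Analysis.Analysis"
begin

(* Functions on (0, infinity) are total functions on the reals whose values outside
   (0, infinity) are irrelevant. *)

text \<open>Only meant for open S, where continuity and one-sided limits at a point of S depend
  on the restriction of u to S alone.\<close>

definition piecewise_continuous_on :: "real set \<Rightarrow> (real \<Rightarrow> 'a::topological_space) \<Rightarrow> bool" where
  "piecewise_continuous_on S u \<longleftrightarrow>
     finite {t \<in> S. \<not> isCont u t} \<and>
     (\<forall>t\<in>S. (\<exists>l. (u \<longlongrightarrow> l) (at_left t)) \<and> (\<exists>l. (u \<longlongrightarrow> l) (at_right t)))"

definition PC :: "'a::topological_space set \<Rightarrow> (real \<Rightarrow> 'a) set" where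
  "PC E = {u. piecewise_continuous_on {0<..} u \<and>
              (\<forall>t>0. continuous (at_left t) u) \<and>
              (\<forall>t>0. u t \<in> E)}"

text \<open>At a jump of the control the state is only required to be continuous. Together with
  the equation at the continuity points of the control this determines the state.\<close>

definition state_solution ::
  "real^'n^'n \<Rightarrow> real^'m^'n \<Rightarrow> real^'n \<Rightarrow> (real \<Rightarrow> real^'m) \<Rightarrow> (real \<Rightarrow> real^'n) \<Rightarrow> bool" where
  "state_solution A B x0 u x \<longleftrightarrow>
     x 0 = x0 \<and> continuous_on {0..} x \<and>
     (\<forall>t>0. isCont u t \<longrightarrow> (x has_vector_derivative (A *v x t + B *v u t)) (at t))"

definition reaches_zero_at ::
  "real^'n^'n \<Rightarrow> real^'m^'n \<Rightarrow> real^'n \<Rightarrow> (real \<Rightarrow> real^'m) \<Rightarrow> real \<Rightarrow> bool" where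
  "reaches_zero_at A B x0 u t \<longleftrightarrow> (\<exists>x. state_solution A B x0 u x \<and> x t = 0)"

definition admissible_control ::
  "real^'n^'n \<Rightarrow> real^'m^'n \<Rightarrow> real^'n \<Rightarrow> (real \<Rightarrow> real^'m) \<Rightarrow> bool" where
  "admissible_control A B x0 u \<longleftrightarrow> u \<in> PC (cball 0 1) \<and> (\<exists>t>0. reaches_zero_at A B x0 u t)"

definition optimal_time :: "real^'n^'n \<Rightarrow> real^'m^'n \<Rightarrow> real^'n \<Rightarrow> real" where
  "optimal_time A B x0 = Inf {t. t > 0 \<and> (\<exists>u \<in> PC (cball 0 1). reaches_zero_at A B x0 u t)}"

definition optimal_control ::
  "real^'n^'n \<Rightarrow> real^'m^'n \<Rightarrow> real^'n \<Rightarrow> (real \<Rightarrow> real^'m) \<Rightarrow> bool" where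
  "optimal_control A B x0 u \<longleftrightarrow>
     u \<in> PC (cball 0 1) \<and>
     reaches_zero_at A B x0 u (optimal_time A B x0) \<and>
     (\<forall>t > optimal_time A B x0. u t = 0)"

text \<open>For a function with values in the unit sphere, staying in one direction means being
  constant. The value 0 is compatible with every direction, so that the negation below also
  excludes vanishing on an interval.\<close>

definition one_direction_on :: "real set \<Rightarrow> (real \<Rightarrow> 'a::real_normed_vector) \<Rightarrow> bool" where
  "one_direction_on I u \<longleftrightarrow> (\<exists>v \<in> sphere 0 1. \<forall>t\<in>I. \<exists>r\<ge>0. u t = r *\<^sub>R v)"

definition never_one_direction :: "real \<Rightarrow> (real \<Rightarrow> 'a::real_normed_vector) \<Rightarrow> bool" where
  "never_one_direction T u \<longleftrightarrow>
     (\<forall>a b. 0 \<le> a \<and> a < b \<and> b \<le> T \<longrightarrow> \<not> one_direction_on {a<..<b} u)"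

definition step_function_on :: "real set \<Rightarrow> (real \<Rightarrow> 'a) \<Rightarrow> bool" where
  "step_function_on S u \<longleftrightarrow>
     (\<exists>D. finite D \<and> (\<forall>a b. {a<..<b} \<subseteq> S - D \<longrightarrow> u constant_on {a<..<b}))"

definition behaviour_A1 :: "real \<Rightarrow> (real \<Rightarrow> 'a::real_normed_vector) \<Rightarrow> bool" where
  "behaviour_A1 T u \<longleftrightarrow> (\<exists>v \<in> sphere 0 1. \<forall>t \<in> {0<..<T}. u t = v)"

definition behaviour_A2 :: "real \<Rightarrow> (real \<Rightarrow> 'a::real_normed_vector) \<Rightarrow> bool" where
  "behaviour_A2 T u \<longleftrightarrow>
     continuous_on {0<..<T} u \<and> u ` {0<..<T} \<subseteq> sphere 0 1 \<and> never_one_direction T u"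

definition behaviour_A3 :: "real \<Rightarrow> (real \<Rightarrow> 'a::real_normed_vector) \<Rightarrow> bool" where
  "behaviour_A3 T u \<longleftrightarrow>
     \<not> u constant_on {0<..<T} \<and> step_function_on {0<..<T} u \<and>
     (\<exists>v \<in> sphere 0 1. u ` {0<..<T} = {v, - v})"

text \<open>Piecewise continuous is here opposed to continuous: at least one discontinuity is
  required, since otherwise the second behaviour would be an instance of the fourth and the
  alternatives would not be mutually exclusive.\<close>

definition behaviour_A4 :: "real \<Rightarrow> (real \<Rightarrow> 'a::real_normed_vector) \<Rightarrow> bool" where
  "behaviour_A4 T u \<longleftrightarrow>
     \<not> u constant_on {0<..<T} \<and>
     piecewise_continuous_on {0<..<T} u \<and> \<not> continuous_on {0<..<T} u \<and>
     never_one_direction T u"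

end

theory Submission
  imports Defs
begin

text \<open>The proof rests on Pontryagin's maximum principle and on the analyticity of the switching
  function.

  Write the state at time t as \<open>exp(t A) y(t)\<close>. A control u steers \<open>x0\<close> to 0 at time s exactly
  if \<open>- x0\<close> is the integral of \<open>exp(- t A) B u(t)\<close> over [0, s] (lemmas
  \<open>reaches_zero_at_imp_integral\<close> and \<open>integral_imp_reaches_zero_at\<close>). The set of all these
  integrals is convex, and for s < T it does not contain \<open>- x0\<close>. Separating \<open>- x0\<close> from the sets
  for s < T and letting s tend to T yields a vector z such that \<open>- x0\<close> maximises the inner
  product with z over the set for time T. With \<open>f(t) = B\<^sup>T exp(- t A)\<^sup>T z\<close> this means that the
  optimal control maximises the integral of \<open>f \<bullet> u\<close>, and hence that \<open>u(t)\<close> maximises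
  \<open>f(t) \<bullet> v\<close> over the unit ball at every continuity point t of u in (0, T) (lemma
  \<open>maximum_principle\<close>). The vector z is chosen nonzero in the span of all these sets of
  integrals, which guarantees that f does not vanish identically.

  The components of f are entire power series in t. So f vanishes on no interval, the control
  equals \<open>f / |f|\<close> at a dense set of times, and being left continuous it has norm one
  throughout (0, T). Suppose it is constant, equal to v, on some subinterval. Then all components
  of f orthogonal to v vanish on that subinterval, hence everywhere, and u only takes the
  values v and - v (lemma \<open>bang_bang_dichotomy\<close>): it is constant, or a step function with two
  opposite values. Otherwise u stays in one direction on no subinterval, and then it is either
  continuous or it is not.\<close>

section \<open>The matrix exponential\<close>

lemma matrix_matrix_mult_add_rdistrib: "(B + C) ** A = B ** A + C ** A" for A :: "real^'k^'n" and B :: "real^'n^'m"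
  by (vector matrix_matrix_mult_def sum.distrib[symmetric] field_simps)

lemma bounded_bilinear_matrix_mult:
  "bounded_bilinear ((**) :: real^'n^'m \<Rightarrow> real^'k^'n \<Rightarrow> real^'k^'m)"
proof -
  have "linear (\<lambda>Y :: real^'k^'n. X ** Y)" for X :: "real^'n^'m"
    by (rule linearI) (simp_all only: matrix_add_ldistrib matrix_scalar_ac scalar_matrix_assoc)
  moreover have "linear (\<lambda>X :: real^'n^'m. X ** Y)" for Y :: "real^'k^'n"
    by (rule linearI) (simp_all only: matrix_matrix_mult_add_rdistrib scalar_matrix_assoc)
  ultimately show ?thesis
    unfolding bilinear_conv_bounded_bilinear[symmetric] bilinear_def by blast
qed

lemma bounded_bilinear_matrix_vector_mult:
  "bounded_bilinear ((*v) :: real^'n^'m \<Rightarrow> real^'n \<Rightarrow> real^'m)"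
proof -
  have "linear (\<lambda>y. X *v y)" for X :: "real^'n^'m"
    by (rule matrix_vector_mul_linear)
  moreover have "linear (\<lambda>X :: real^'n^'m. X *v y)" for y :: "real^'n"
    by (rule linearI) (simp_all only: matrix_vector_mult_add_rdistrib scaleR_matrix_vector_assoc)
  ultimately show ?thesis
    unfolding bilinear_conv_bounded_bilinear[symmetric] bilinear_def by blast
qed

primrec mpow :: "real^'n^'n \<Rightarrow> nat \<Rightarrow> real^'n^'n" where
  "mpow A 0 = mat 1"
| "mpow A (Suc k) = A ** mpow A k"

definition mexp :: "real^'n^'n \<Rightarrow> real \<Rightarrow> real^'n^'n" where
  "mexp A t = (\<Sum>k. (t ^ k / fact k) *\<^sub>R mpow A k)"

lemma mpow_commute: "A ** mpow A k = mpow A k ** A"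
proof (induction k)
  case (Suc k)
  then show ?case
    by (metis matrix_mul_assoc mpow.simps(2))
qed simp

lemma mexp_sums:
  fixes A :: "real^'n^'n"
  shows "(\<lambda>k. (t ^ k / fact k) *\<^sub>R mpow A k) sums mexp A t"
proof -
  interpret bounded_bilinear "(**) :: real^'n^'n \<Rightarrow> real^'n^'n \<Rightarrow> real^'n^'n"
    by (rule bounded_bilinear_matrix_mult)
  from pos_bounded obtain K
    where K: "K > 0" "\<forall>(X :: real^'n^'n) (Y :: real^'n^'n). norm (X ** Y) \<le> norm X * norm Y * K"
    by blast
  define q where "q = norm A * K"
  have q: "q \<ge> 0" using K by (simp add: q_def)
  have pow: "norm (mpow A k) \<le> norm (mat 1 :: real^'n^'n) * q ^ k" for k
  proof (induction k)
    case (Suc k)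
    have "norm (mpow A (Suc k)) \<le> q * norm (mpow A k)"
      using K(2)[rule_format, of A "mpow A k"] by (simp add: q_def mult_ac)
    also have "\<dots> \<le> q * (norm (mat 1 :: real^'n^'n) * q ^ k)"
      using Suc q by (intro mult_left_mono)
    finally show ?case by (simp add: mult_ac)
  qed simp
  have "summable (\<lambda>k. (t ^ k / fact k) *\<^sub>R mpow A k)"
  proof (rule summable_comparison_test')
    show "summable (\<lambda>k. norm (mat 1 :: real^'n^'n) * (inverse (fact k) * (\<bar>t\<bar> * q) ^ k))"
      by (intro summable_mult summable_exp)
    show "norm ((t ^ k / fact k) *\<^sub>R mpow A k)
        \<le> norm (mat 1 :: real^'n^'n) * (inverse (fact k) * (\<bar>t\<bar> * q) ^ k)" if "k \<ge> 0" for k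
    proof -
      have "norm ((t ^ k / fact k) *\<^sub>R mpow A k) = \<bar>t\<bar> ^ k / fact k * norm (mpow A k)"
        by (simp add: power_abs)
      also have "\<dots> \<le> \<bar>t\<bar> ^ k / fact k * (norm (mat 1 :: real^'n^'n) * q ^ k)"
        by (intro mult_left_mono pow) auto
      finally show ?thesis by (simp add: field_simps power_mult_distrib)
    qed
  qed
  then show ?thesis
    unfolding mexp_def by (rule summable_sums)
qed

lemma mexp_0 [simp]: "mexp A 0 = mat 1"
proof -
  have "(\<lambda>k. ((0::real) ^ k / fact k) *\<^sub>R mpow A k) sums
      (\<Sum>k\<in>{0}. ((0::real) ^ k / fact k) *\<^sub>R mpow A k)"
    by (rule sums_finite) auto
  from sums_unique2[OF mexp_sums this] show ?thesis by simp
qed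

lemma mexp_commute:
  fixes A :: "real^'n^'n"
  shows "A ** mexp A t = mexp A t ** A"
proof -
  interpret bounded_bilinear "(**) :: real^'n^'n \<Rightarrow> real^'n^'n \<Rightarrow> real^'n^'n"
    by (rule bounded_bilinear_matrix_mult)
  have left: "(\<lambda>k. A ** ((t ^ k / fact k) *\<^sub>R mpow A k)) sums (A ** mexp A t)"
    by (rule bounded_linear.sums[OF bounded_linear_right mexp_sums])
  have "(\<lambda>k. ((t ^ k / fact k) *\<^sub>R mpow A k) ** A) sums (mexp A t ** A)"
    by (rule bounded_linear.sums[OF bounded_linear_left mexp_sums])
  moreover have "((t ^ k / fact k) *\<^sub>R mpow A k) ** A = A ** ((t ^ k / fact k) *\<^sub>R mpow A k)" for k
    by (simp only: scaleR_left scaleR_right mpow_commute)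
  ultimately have "(\<lambda>k. A ** ((t ^ k / fact k) *\<^sub>R mpow A k)) sums (mexp A t ** A)"
    by (simp only:)
  with left show ?thesis by (rule sums_unique2)
qed

text \<open>Each coordinate of the exponential series is a real power series that converges everywhere,
  so it may be differentiated term by term, and this merely shifts the index.\<close>

lemma mexp_has_vector_derivative:
  fixes A :: "real^'n^'n"
  shows "(mexp A has_vector_derivative (A ** mexp A t)) (at t within S)"
proof -
  interpret bounded_bilinear "(**) :: real^'n^'n \<Rightarrow> real^'n^'n \<Rightarrow> real^'n^'n"
    by (rule bounded_bilinear_matrix_mult)
  have "((\<lambda>t. mexp A t \<bullet> b) has_derivative (\<lambda>h. (h *\<^sub>R (A ** mexp A t)) \<bullet> b)) (at t)" for b
  proof -
    define c where "c k = (mpow A k \<bullet> b) / fact k" for k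
    have ser: "(\<lambda>k. c k * t ^ k) sums (mexp A t \<bullet> b)" for t
      using bounded_linear.sums[OF bounded_linear_inner_left mexp_sums[of t A], of b]
      by (simp add: c_def field_simps)
    have eq: "(\<Sum>k. c k * t ^ k) = mexp A t \<bullet> b" for t
      using sums_unique[OF ser] by simp
    have "((\<lambda>t. \<Sum>k. c k * t ^ k) has_field_derivative (\<Sum>k. diffs c k * t ^ k)) (at t)"
      using ser by (intro termdiffs_strong_converges_everywhere) (auto simp: sums_iff)
    moreover have "(\<lambda>k. diffs c k * t ^ k) sums ((A ** mexp A t) \<bullet> b)"
    proof -
      have "(\<lambda>k. (A ** ((t ^ k / fact k) *\<^sub>R mpow A k)) \<bullet> b) sums ((A ** mexp A t) \<bullet> b)"
        by (intro bounded_linear.sums[OF bounded_linear_inner_left]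
              bounded_linear.sums[OF bounded_linear_right] mexp_sums)
      then show ?thesis
        by (simp add: c_def diffs_def scaleR_right field_simps del: of_nat_Suc)
    qed
    ultimately have "((\<lambda>t. mexp A t \<bullet> b) has_field_derivative ((A ** mexp A t) \<bullet> b)) (at t)"
      by (simp add: eq sums_unique[symmetric])
    then show ?thesis
      by (simp add: has_field_derivative_def mult.commute[of "(A ** mexp A t) \<bullet> b"] mult_commute_abs)
  qed
  then have "(mexp A has_vector_derivative (A ** mexp A t)) (at t)"
    unfolding has_vector_derivative_def
    by (subst has_derivative_componentwise_within) blast
  then show ?thesis
    by (rule has_vector_derivative_at_within)
qed

lemma mexp_compose_has_vector_derivative:
  assumes "(f has_vector_derivative d) (at t within S)"
  shows "((\<lambda>t. mexp A (f t)) has_vector_derivative d *\<^sub>R (A ** mexp A (f t))) (at t within S)"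
  using vector_diff_chain_within[OF assms mexp_has_vector_derivative] by (simp add: o_def)

lemma mexp_minus_has_vector_derivative:
  "((\<lambda>t. mexp A (- t)) has_vector_derivative - (A ** mexp A (- t))) (at t within S)"
  using mexp_compose_has_vector_derivative[of uminus "-1" t S A]
  by (simp add: has_vector_derivative_minus)

lemma continuous_on_mexp [continuous_intros]:
  assumes "continuous_on S f"
  shows "continuous_on S (\<lambda>x. mexp A (f x))"
proof -
  have "continuous_on UNIV (mexp A)"
    by (metis continuous_at_imp_continuous_on has_vector_derivative_continuous
        mexp_has_vector_derivative)
  from continuous_on_compose2[OF this assms] show ?thesis by auto
qed

text \<open>The product rule shows that the left-hand side has derivative 0 in s, since A commutes
  with its exponential. The case t = 0 makes every exponential invertible; from there the
  functional equation of the exponential follows.\<close>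

lemma mexp_add_mult_minus: "mexp A (t + s) ** mexp A (- s) = mexp A t"
proof -
  define F where "F s = mexp A (t + s) ** mexp A (- s)" for s
  have "(F has_vector_derivative 0) (at s within UNIV)" for s
  proof -
    have 1: "((\<lambda>s. mexp A (t + s)) has_vector_derivative (A ** mexp A (t + s))) (at s)"
      using mexp_compose_has_vector_derivative[of "\<lambda>s. t + s" 1 s UNIV A]
      by (simp add: add.commute[of t] has_vector_derivative_add_const)
    have 2: "mexp A (t + s) ** - (A ** mexp A (- s)) + (A ** mexp A (t + s)) ** mexp A (- s) = 0"
      by (simp add: mexp_commute[of A "t + s"] matrix_mul_assoc 
          bounded_bilinear.minus_right[OF bounded_bilinear_matrix_mult])
    show ?thesis
      using bounded_bilinear.has_vector_derivative[OF bounded_bilinear_matrix_mult 1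
          mexp_minus_has_vector_derivative[of A]]
      unfolding F_def 2 .
  qed
  then have "\<exists>c. \<forall>s\<in>UNIV. F s = c"
    by (intro has_derivative_zero_constant) (auto simp: has_vector_derivative_def)
  then have "F s = F 0" by auto
  then show ?thesis by (simp add: F_def)
qed

lemma mexp_mult_minus: "mexp A s ** mexp A (- s) = mat 1"
  using mexp_add_mult_minus[of A 0 s] by simp

lemma mexp_add: "mexp A (t + s) = mexp A t ** mexp A s"
  using mexp_add_mult_minus[of A "t + s" "- s"] by simp

text \<open>The identity theorem for the functions \<open>z \<bullet> exp(t A) y\<close>, which are analytic: if such a
  function vanishes on an interval, then so do all its derivatives
  \<open>z \<bullet> exp(t A) A\<^sup>k y\<close>, and these are, up to factorials, its Taylor coefficients at the midpoint
  of that interval; the Taylor series represents it on the whole line.\<close>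

lemma mexp_apply_analytic:
  assumes "a < b" and zero: "\<And>t. t \<in> {a<..<b} \<Longrightarrow> z \<bullet> (mexp A t *v y) = 0"
  shows "z \<bullet> (mexp A t *v y) = 0"
proof -
  have deriv: "((\<lambda>t. z \<bullet> (mexp A t *v x)) has_vector_derivative z \<bullet> (mexp A t *v (A *v x))) (at t)" for t x
  proof -
    have "((\<lambda>t. mexp A t *v x) has_vector_derivative (A ** mexp A t) *v x) (at t)"
      by (rule bounded_linear.has_vector_derivative[OF bounded_bilinear.bounded_linear_left[
            OF bounded_bilinear_matrix_vector_mult] mexp_has_vector_derivative])
    then show ?thesis
      by (intro bounded_linear.has_vector_derivative[OF bounded_linear_inner_right])
         (simp add: mexp_commute matrix_vector_mul_assoc)
  qed
  have all: "z \<bullet> (mexp A t *v (mpow A k *v y)) = 0" if "t \<in> {a<..<b}" for t k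
    using that
  proof (induction k arbitrary: t)
    case (Suc k)
    have "((\<lambda>t. z \<bullet> (mexp A t *v (mpow A k *v y))) has_vector_derivative 0) (at t)"
      by (rule has_vector_derivative_transform_within_open[of "\<lambda>_. 0" _ _ "{a<..<b}"])
        (use Suc in auto)
    from vector_derivative_unique_at[OF this deriv] show ?case
      by (simp add: matrix_vector_mul_assoc)
  qed (use zero in auto)
  \<comment> \<open>Expand \<open>exp(t A) y = exp(c A) exp((t - c) A) y\<close> by the series of the second factor.\<close>
  define c where "c = (a + b) / 2"
  have c: "c \<in> {a<..<b}" using \<open>a < b\<close> by (simp add: c_def)
  have "(\<lambda>k. z \<bullet> (mexp A c *v (((t - c) ^ k / fact k) *\<^sub>R mpow A k *v y)))
      sums (z \<bullet> (mexp A c *v (mexp A (t - c) *v y)))"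
    by (intro bounded_linear.sums[OF bounded_linear_inner_right]
        bounded_linear.sums[OF matrix_vector_mul_bounded_linear]
        bounded_linear.sums[OF bounded_bilinear.bounded_linear_left[
            OF bounded_bilinear_matrix_vector_mult]] mexp_sums)
  moreover have "z \<bullet> (mexp A c *v (((t - c) ^ k / fact k) *\<^sub>R mpow A k *v y)) = 0" for k
    using all[OF c, of k] 
    by (simp add: scaleR_matrix_vector_assoc[symmetric] matrix_vector_mult_scaleR)
  ultimately have "z \<bullet> (mexp A c *v (mexp A (t - c) *v y)) = 0"
    by (simp add: sums_unique2[OF _ sums_zero])
  then show ?thesis
    by (simp add: matrix_vector_mul_assoc mexp_add[symmetric])
qed

section \<open>Piecewise continuous controls\<close>

lemma PC_const: "v \<in> E \<Longrightarrow> (\<lambda>_. v) \<in> PC E"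
  by (auto simp: PC_def piecewise_continuous_on_def intro!: tendsto_const)

lemma PC_finite_discontinuities: "u \<in> PC E \<Longrightarrow> finite {t. t > 0 \<and> \<not> isCont u t}"
  by (simp add: PC_def piecewise_continuous_on_def)

lemma PC_left_continuous: "u \<in> PC E \<Longrightarrow> t > 0 \<Longrightarrow> (u \<longlongrightarrow> u t) (at_left t)"
  by (auto simp: PC_def continuous_within)

lemma PC_in: "u \<in> PC E \<Longrightarrow> t > 0 \<Longrightarrow> u t \<in> E"
  by (simp add: PC_def)

lemma PC_convex:
  fixes E :: "'a::real_normed_vector set"
  assumes "convex E" "u \<in> PC E" "w \<in> PC E" "0 \<le> c" "c \<le> 1"
  shows "(\<lambda>t. (1 - c) *\<^sub>R u t + c *\<^sub>R w t) \<in> PC E" (is "?v \<in> _")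
proof -
  have "{t. 0 < t \<and> \<not> isCont ?v t} \<subseteq> {t. 0 < t \<and> \<not> isCont u t} \<union> {t. 0 < t \<and> \<not> isCont w t}"
    by (auto intro!: continuous_intros)
  then have "finite {t. 0 < t \<and> \<not> isCont ?v t}"
    using PC_finite_discontinuities assms(2,3) finite_subset by blast
  moreover have "\<exists>l. (?v \<longlongrightarrow> l) F" if "\<exists>l. (u \<longlongrightarrow> l) F" "\<exists>l. (w \<longlongrightarrow> l) F" for F
  proof -
    from that obtain l l' where "(u \<longlongrightarrow> l) F" "(w \<longlongrightarrow> l') F" by blast
    then have "(?v \<longlongrightarrow> (1 - c) *\<^sub>R l + c *\<^sub>R l') F"
      by (intro tendsto_intros)
    then show ?thesis ..
  qed
  moreover have "?v t \<in> E" if "t > 0" for t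
    using assms that by (intro convexD) (auto simp: PC_in)
  ultimately show ?thesis
    using assms(2,3) by (auto simp: PC_def piecewise_continuous_on_def intro!: continuous_intros)
qed

text \<open>Switching from one control to another at time s. The value at s itself is that of the
  earlier control, which is what left continuity demands.\<close>

lemma PC_splice:
  assumes u: "u \<in> PC E" and w: "w \<in> PC E"
  shows "(\<lambda>t. if t \<le> s then u t else w t) \<in> PC E" (is "?v \<in> _")
proof -
  have left: "\<forall>\<^sub>F x in nhds t. u x = ?v x" if "t < s" for t
    using eventually_nhds_in_open[of "{..<s}" t] that by (auto elim: eventually_mono)
  have right: "\<forall>\<^sub>F x in nhds t. w x = ?v x" if "t > s" for t
    using eventually_nhds_in_open[of "{s<..}" t] that by (auto elim!: eventually_mono)
  have cont: "isCont ?v t" if "t > 0" "t \<noteq> s" "isCont u t" "isCont w t" for t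
    using that isCont_cong[OF left, of t] isCont_cong[OF right, of t] by (cases "t < s") auto
  then have "{t. 0 < t \<and> \<not> isCont ?v t} \<subseteq>
      insert s ({t. 0 < t \<and> \<not> isCont u t} \<union> {t. 0 < t \<and> \<not> isCont w t})"
    by blast
  moreover have "finite (insert s ({t. 0 < t \<and> \<not> isCont u t} \<union> {t. 0 < t \<and> \<not> isCont w t}))"
    using PC_finite_discontinuities u w by blast
  ultimately have fin: "finite {t. 0 < t \<and> \<not> isCont ?v t}"
    using finite_subset by blast
  \<comment> \<open>Just before t the spliced control is u if \<open>t \<le> s\<close>, just after t only if \<open>t < s\<close>.\<close>
  have at_left: "(?v \<longlongrightarrow> l) (at_left t) \<longleftrightarrow> ((if t \<le> s then u else w) \<longlongrightarrow> l) (at_left t)" for l t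
  proof (rule filterlim_cong[OF refl refl])
    show "\<forall>\<^sub>F x in at_left t. ?v x = (if t \<le> s then u else w) x"
      using eventually_at_left_real[of s t] right[of t]
      by (cases "t \<le> s") (auto simp: eventually_at_filter elim: eventually_mono)
  qed
  have at_right: "(?v \<longlongrightarrow> l) (at_right t) \<longleftrightarrow> ((if t < s then u else w) \<longlongrightarrow> l) (at_right t)" for l t
  proof (rule filterlim_cong[OF refl refl])
    show "\<forall>\<^sub>F x in at_right t. ?v x = (if t < s then u else w) x"
      using left[of t] right[of t]
      by (cases "t < s") (auto simp: eventually_at_filter elim: eventually_mono)
  qed
  show ?thesis
    using fin u w unfolding PC_def piecewise_continuous_on_def continuous_within mem_Collect_eq at_left at_right
    by auto
qed

section \<open>Variation of constants\<close>

lemma integrable_bounded_finite_discontinuities: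
  fixes f :: "real \<Rightarrow> 'a::euclidean_space"
  assumes "finite D" and cont: "\<And>t. t \<in> {a<..<b} - D \<Longrightarrow> isCont f t"
    and bound: "\<And>t. t \<in> {a<..<b} \<Longrightarrow> norm (f t) \<le> C"
  shows "f integrable_on {a..b}"
proof -
  let ?S = "{a<..<b} - D"
  have "open ?S"
    using \<open>finite D\<close> by (intro open_Diff finite_imp_closed) auto
  then have S: "?S \<in> lmeasurable"
    by (intro bounded_set_imp_lmeasurable) (auto intro: bounded_subset[of "{a..b}"])
  have "f integrable_on ?S"
  proof (rule measurable_bounded_by_integrable_imp_integrable)
    show "f \<in> borel_measurable (lebesgue_on ?S)"
      using S cont by (intro continuous_imp_measurable_on_sets_lebesgue continuous_at_imp_continuous_on) auto
    show "(\<lambda>_. C) integrable_on ?S"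
      using S by (rule integrable_on_const)
    show "?S \<in> sets lebesgue"
      using S by auto
  qed (use bound in auto)
  then show ?thesis
  proof (rule integrable_spike_set)
    have "negligible (insert a (insert b D))"
      using \<open>finite D\<close> by (intro negligible_finite) auto
    then show "negligible {x \<in> {a..b} - ?S. f x \<noteq> 0}"
      by (rule negligible_subset) auto
  qed (auto intro: negligible_subset[of "{}"])
qed

text \<open>In the coordinates \<open>y = exp(- t A) x\<close>, which carry the free motion back to time 0, the
  control system reads \<open>y' = exp(- t A) B w\<close>; this is its right-hand side. Whether w steers
  \<open>x0\<close> to 0 then depends on a single integral.\<close>

definition pullback :: "real^'n^'n \<Rightarrow> real^'m^'n \<Rightarrow> (real \<Rightarrow> real^'m) \<Rightarrow> real \<Rightarrow> real^'n" where
  "pullback A B w t = mexp A (- t) *v (B *v w t)"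

lemma isCont_pullback:
  assumes "isCont w t"
  shows "isCont (pullback A B w) t"
proof -
  have "isCont (\<lambda>t. mexp A (- t)) t"
    using mexp_minus_has_vector_derivative by (rule has_vector_derivative_continuous)
  then show ?thesis
    unfolding pullback_def[abs_def]
    by (intro bounded_bilinear.isCont[OF bounded_bilinear_matrix_vector_mult]
      bounded_linear.isCont[OF matrix_vector_mul_bounded_linear] assms)
qed

lemma pullback_integrable:
  fixes A :: "real^'n^'n" and B :: "real^'m^'n"
  assumes w: "w \<in> PC (cball 0 1)"
  shows "pullback A B w integrable_on {0..s}"
proof -
  from bounded_bilinear.pos_bounded[OF bounded_bilinear_matrix_vector_mult]
  obtain K where K: "K > 0" "\<forall>(X :: real^'m^'n) y. norm (X *v y) \<le> norm X * norm y * K"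
    by blast
  have "continuous_on {0..s} (\<lambda>t. mexp A (- t) ** B)"
    by (intro bounded_bilinear.continuous_on[OF bounded_bilinear_matrix_mult] continuous_intros)
  then have "bounded ((\<lambda>t. mexp A (- t) ** B) ` {0..s})"
    by (intro compact_imp_bounded compact_continuous_image) auto
  then obtain C where C: "\<And>t. t \<in> {0..s} \<Longrightarrow> norm (mexp A (- t) ** B) \<le> C"
    unfolding bounded_iff by blast
  show ?thesis
  proof (rule integrable_bounded_finite_discontinuities)
    show "finite {t. 0 < t \<and> \<not> isCont w t}"
      using w by (rule PC_finite_discontinuities)
    show "isCont (pullback A B w) t" if "t \<in> {0<..<s} - {t. 0 < t \<and> \<not> isCont w t}" for t
      using that by (intro isCont_pullback) auto
    show "norm (pullback A B w t) \<le> C * K" if "t \<in> {0<..<s}" for t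
    proof -
      have "norm (pullback A B w t) \<le> norm (mexp A (- t) ** B) * norm (w t) * K"
        unfolding pullback_def matrix_vector_mul_assoc using K(2) by blast
      also have "\<dots> \<le> C * 1 * K"
        using that K(1) C[of t] PC_in[OF w, of t]
        by (intro mult_right_mono mult_mono) (auto intro: order_trans[OF norm_ge_zero])
      finally show ?thesis by simp
    qed
  qed
qed

lemma pullback_state_has_vector_derivative:
  assumes "(x has_vector_derivative (A *v x t + B *v w t)) (at t)"
  shows "((\<lambda>t. mexp A (- t) *v x t) has_vector_derivative pullback A B w t) (at t)"
proof -
  have "mexp A (- t) *v (A *v x t + B *v w t) + - (A ** mexp A (- t)) *v x t = pullback A B w t"
    by (simp add: pullback_def mexp_commute matrix_vector_right_distrib matrix_vector_mul_assoc
        bounded_bilinear.minus_left[OF bounded_bilinear_matrix_vector_mult])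
  with bounded_bilinear.has_vector_derivative[OF bounded_bilinear_matrix_vector_mult
      mexp_minus_has_vector_derivative[of A t UNIV] assms]
  show ?thesis by simp
qed

text \<open>The fundamental theorem of calculus for \<open>exp(- t A) x(t)\<close>. It tolerates the finitely many
  jumps of the control because the state is continuous there.\<close>

lemma reaches_zero_at_imp_integral:
  assumes w: "w \<in> PC (cball 0 1)" and "0 \<le> s" and "reaches_zero_at A B x0 w s"
  shows "integral {0..s} (pullback A B w) = - x0"
proof -
  obtain x where x: "state_solution A B x0 w x" "x s = 0"
    using assms(3) by (auto simp: reaches_zero_at_def)
  have "(pullback A B w has_integral (mexp A (- s) *v x s - mexp A (- 0) *v x 0)) {0..s}"
  proof (rule fundamental_theorem_of_calculus_interior_strong)
    show "finite {t. 0 < t \<and> \<not> isCont w t}"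
      using w by (rule PC_finite_discontinuities)
    show "((\<lambda>t. mexp A (- t) *v x t) has_vector_derivative pullback A B w t) (at t)"
      if "t \<in> {0<..<s} - {t. 0 < t \<and> \<not> isCont w t}" for t
      using that x(1) by (intro pullback_state_has_vector_derivative) (auto simp: state_solution_def)
    have "continuous_on {0..s} x"
      using x(1) by (auto simp: state_solution_def intro: continuous_on_subset)
    then show "continuous_on {0..s} (\<lambda>t. mexp A (- t) *v x t)"
      by (intro bounded_bilinear.continuous_on[OF bounded_bilinear_matrix_vector_mult] continuous_intros)
  qed fact
  then show ?thesis
    using x by (simp add: state_solution_def integral_unique)
qed

text \<open>Conversely the variation of constants formula provides the state.\<close>

lemma integral_imp_reaches_zero_at:
  assumes w: "w \<in> PC (cball 0 1)" and "integral {0..s} (pullback A B w) = - x0"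
  shows "reaches_zero_at A B x0 w s"
proof -
  define y where "y t = x0 + integral {0..t} (pullback A B w)" for t
  define x where "x t = mexp A t *v y t" for t
  have "continuous_on {0..} y"
    unfolding y_def
  proof (intro continuous_intros)
    show "continuous_on {0..} (\<lambda>t. integral {0..t} (pullback A B w))"
      unfolding continuous_on_eq_continuous_within
    proof
      fix t :: real assume "t \<in> {0..}"
      \<comment> \<open>The indefinite integral is continuous on compact intervals; the right endpoint t + 1
        keeps t away from the border.\<close>
      have "continuous_on {0..t + 1} (\<lambda>t. integral {0..t} (pullback A B w))"
        by (intro indefinite_integral_continuous_1 pullback_integrable w)
      then have "continuous (at t within {0..t + 1}) (\<lambda>t. integral {0..t} (pullback A B w))"
        using \<open>t \<in> {0..}\<close> by (simp add: continuous_on_eq_continuous_within)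
      moreover have "at t within {0..t + 1} = at t within {0..}"
        by (rule at_within_nhd[of _ "{..<t + 1}"]) auto
      ultimately show "continuous (at t within {0..}) (\<lambda>t. integral {0..t} (pullback A B w))"
        by simp
    qed
  qed
  then have "continuous_on {0..} x"
    unfolding x_def
    by (intro bounded_bilinear.continuous_on[OF bounded_bilinear_matrix_vector_mult] continuous_intros)
  moreover have "(x has_vector_derivative (A *v x t + B *v w t)) (at t)" if t: "t > 0" "isCont w t" for t
  proof -
    have "((\<lambda>t. integral {0..t} (pullback A B w)) has_vector_derivative pullback A B w t)
        (at t within {0..t + 1} - {})"
      using t isCont_pullback[OF t(2)]
      by (intro integral_has_vector_derivative_continuous_at pullback_integrable w)
        (auto intro: continuous_at_imp_continuous_at_within)
    then have "(y has_vector_derivative pullback A B w t) (at t within {0..t + 1})"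
      unfolding y_def using has_vector_derivative_add[OF has_vector_derivative_const] by fastforce
    then have y: "(y has_vector_derivative pullback A B w t) (at t)"
      using t by (simp add: at_within_Icc_at)
    have "mexp A t *v pullback A B w t + (A ** mexp A t) *v y t = A *v x t + B *v w t"
      by (simp add: pullback_def x_def matrix_vector_mul_assoc matrix_mul_assoc mexp_mult_minus)
    with bounded_bilinear.has_vector_derivative[OF bounded_bilinear_matrix_vector_mult
        mexp_has_vector_derivative[of A t UNIV] y]
    show ?thesis
      unfolding x_def by simp
  qed
  moreover have "x 0 = x0" "x s = 0"
    using assms(2) by (auto simp: x_def y_def)
  ultimately show ?thesis
    unfolding reaches_zero_at_def state_solution_def by blast
qed

section \<open>The maximum principle\<close>

text \<open>The initial states that can be steered to 0 at time s are the negatives of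
  the elements of this set.\<close>

definition reach :: "real^'n^'n \<Rightarrow> real^'m^'n \<Rightarrow> real \<Rightarrow> (real^'n) set" where
  "reach A B s = (\<lambda>w. integral {0..s} (pullback A B w)) ` PC (cball 0 1)"

lemma pullback_affine:
  "pullback A B (\<lambda>t. (1 - c) *\<^sub>R u t + c *\<^sub>R w t) t = (1 - c) *\<^sub>R pullback A B u t + c *\<^sub>R pullback A B w t"
  by (simp add: pullback_def matrix_vector_right_distrib matrix_vector_mult_scaleR)

lemma convex_reach: "convex (reach A B s)"
  unfolding convex_alt
proof (intro ballI allI impI)
  fix x y c assume "x \<in> reach A B s" "y \<in> reach A B s" "0 \<le> c \<and> c \<le> (1::real)"
  then obtain u w where uw: "u \<in> PC (cball 0 1)" "w \<in> PC (cball 0 1)"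
    "x = integral {0..s} (pullback A B u)" "y = integral {0..s} (pullback A B w)"
    by (auto simp: reach_def)
  have "integral {0..s} (pullback A B (\<lambda>t. (1 - c) *\<^sub>R u t + c *\<^sub>R w t))
     = (1 - c) *\<^sub>R x + c *\<^sub>R y"
    unfolding pullback_affine[abs_def] uw
    using uw(1,2) by (subst integral_add) (auto intro!: integrable_cmul pullback_integrable)
  moreover have "(\<lambda>t. (1 - c) *\<^sub>R u t + c *\<^sub>R w t) \<in> PC (cball 0 1)"
    using uw \<open>0 \<le> c \<and> c \<le> 1\<close> by (intro PC_convex) auto
  ultimately show "(1 - c) *\<^sub>R x + c *\<^sub>R y \<in> reach A B s"
    unfolding reach_def by (intro image_eqI[OF sym])
qed

text \<open>A point outside every member of a family of convex sets is separated from their limit as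
  well: unit normals of separating hyperplanes accumulate at a unit normal. The normals are
  kept inside a subspace R that contains the point and all the sets. When R is spanned by the sets, the limiting normal cannot be orthogonal to all of them, so the separation is
  not vacuous even though the sets may lie in a proper subspace of the whole space.\<close>

lemma limit_separation:
  fixes K :: "real \<Rightarrow> 'a::euclidean_space set"
  assumes "T > 0"
    and convex: "\<And>s. 0 < s \<Longrightarrow> s < T \<Longrightarrow> convex (K s)"
    and ne: "\<And>s. 0 < s \<Longrightarrow> s < T \<Longrightarrow> K s \<noteq> {}"
    and out: "\<And>s. 0 < s \<Longrightarrow> s < T \<Longrightarrow> p \<notin> K s"
    and R: "subspace R" "p \<in> R" "\<And>s. 0 < s \<Longrightarrow> s < T \<Longrightarrow> K s \<subseteq> R"
  obtains z where "z \<in> R" "z \<noteq> 0"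
    "\<And>k l. (\<And>s. 0 < s \<Longrightarrow> s < T \<Longrightarrow> k s \<in> K s) \<Longrightarrow> (k \<longlongrightarrow> l) (at_left T) \<Longrightarrow> z \<bullet> l \<le> z \<bullet> p"
proof -
  have sep: "\<exists>z\<in>R \<inter> sphere 0 1. \<forall>k\<in>K s. z \<bullet> k \<le> z \<bullet> p" if s: "0 < s" "s < T" for s
  proof -
    let ?S = "(\<lambda>k. p - k) ` K s"
    have "convex ?S"
      using convex_translation[OF convex_negations[OF convex[OF s]], of p] by (simp add: image_image)
    moreover have "?S \<noteq> {}" "0 \<notin> ?S"
      using ne[OF s] out[OF s] by auto
    ultimately obtain a where a: "a \<in> span ?S" "a \<noteq> 0" "\<And>x. x \<in> ?S \<Longrightarrow> 0 \<le> a \<bullet> x"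
      using separating_hyperplane_set_0_inspan by blast
    have "?S \<subseteq> R"
      using R s by (auto intro!: subspace_diff)
    then have "a \<in> R"
      using a(1) R(1) span_minimal by blast
    show ?thesis
    proof
      show "a /\<^sub>R norm a \<in> R \<inter> sphere 0 1"
        using \<open>a \<in> R\<close> a(2) R(1) by (auto intro: subspace_scale)
      show "\<forall>k\<in>K s. (a /\<^sub>R norm a) \<bullet> k \<le> (a /\<^sub>R norm a) \<bullet> p"
        using a(3)[OF imageI] by (auto simp: inner_diff_right intro!: mult_left_mono)
    qed
  qed
  \<comment> \<open>Times that increase to T; the double successor keeps even the first of them positive.\<close>
  define \<sigma> where "\<sigma> n = T - T * inverse (real (Suc (Suc n)))" for n
  have \<sigma>: "0 < \<sigma> n" "\<sigma> n < T" for n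
    using \<open>T > 0\<close> by (auto simp: \<sigma>_def field_simps intro: add_pos_nonneg)
  have "\<sigma> \<longlonglongrightarrow> T - T * 0"
    unfolding \<sigma>_def by (intro tendsto_intros LIMSEQ_Suc[OF LIMSEQ_inverse_real_of_nat])
  then have lim\<sigma>: "filterlim \<sigma> (at_left T) sequentially"
    using \<sigma> by (auto simp: filterlim_at intro!: always_eventually)
  have "\<forall>n. \<exists>z. z \<in> R \<inter> sphere 0 1 \<and> (\<forall>k\<in>K (\<sigma> n). z \<bullet> k \<le> z \<bullet> p)"
    using sep \<sigma> by blast
  then obtain Z where Z: "\<And>n. Z n \<in> R \<inter> sphere 0 1" "\<And>n k. k \<in> K (\<sigma> n) \<Longrightarrow> Z n \<bullet> k \<le> Z n \<bullet> p"
    by metis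
  have "compact (R \<inter> sphere 0 1)"
    using R(1) by (intro closed_Int_compact closed_subspace) auto
  then obtain z r where z: "z \<in> R \<inter> sphere 0 1" "strict_mono (r :: nat \<Rightarrow> nat)" "(Z \<circ> r) \<longlonglongrightarrow> z"
    using Z(1) unfolding compact_def by metis
  show thesis
  proof
    show "z \<in> R" "z \<noteq> 0" using z(1) by auto
    fix k l assume k: "\<And>s. 0 < s \<Longrightarrow> s < T \<Longrightarrow> k s \<in> K s" and lim: "(k \<longlongrightarrow> l) (at_left T)"
    have "(\<lambda>n. k (\<sigma> (r n))) \<longlonglongrightarrow> l"
      using filterlim_compose[OF lim filterlim_compose[OF lim\<sigma> filterlim_subseq[OF z(2)]]] .
    then have "(\<lambda>n. Z (r n) \<bullet> k (\<sigma> (r n))) \<longlonglongrightarrow> z \<bullet> l" "(\<lambda>n. Z (r n) \<bullet> p) \<longlonglongrightarrow> z \<bullet> p"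
      using z(3) by (auto simp: o_def intro!: tendsto_intros)
    then show "z \<bullet> l \<le> z \<bullet> p"
      by (rule LIMSEQ_le) (use Z(2) k \<sigma> in auto)
  qed
qed

text \<open>From an integral inequality to a pointwise one: if a constant v did better than u at a
  continuity point t, it would do better on a whole neighbourhood of t, and replacing u by v
  there alone would give a competitor with positive integral.\<close>

lemma spike_maximality:
  fixes f u :: "real \<Rightarrow> 'a::euclidean_space"
  assumes u: "u \<in> PC (cball 0 1)" and cont: "\<And>t. isCont f t"
    and int: "\<And>w. w \<in> PC (cball 0 1) \<Longrightarrow> (\<lambda>t. f t \<bullet> (w t - u t)) integrable_on {0..T}"
    and le: "\<And>w. w \<in> PC (cball 0 1) \<Longrightarrow> integral {0..T} (\<lambda>t. f t \<bullet> (w t - u t)) \<le> 0"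
    and t: "0 < t" "t < T" "isCont u t" and v: "norm v \<le> 1"
  shows "f t \<bullet> v \<le> f t \<bullet> u t"
proof (rule ccontr)
  assume less: "\<not> f t \<bullet> v \<le> f t \<bullet> u t"
  define c where "c = f t \<bullet> (v - u t) / 2"
  have c: "c > 0" "c < f t \<bullet> (v - u t)"
    using less by (simp_all add: c_def inner_diff_right)
  have "isCont (\<lambda>x. f x \<bullet> (v - u x)) t"
    by (intro continuous_intros cont t)
  then have "((\<lambda>x. f x \<bullet> (v - u x)) \<longlongrightarrow> f t \<bullet> (v - u t)) (nhds t)"
    using tendsto_at_iff_tendsto_nhds[of "\<lambda>x. f x \<bullet> (v - u x)" t] by (simp add: isCont_def)
  from order_tendstoD(1)[OF this c(2)]
  obtain e where e: "e > 0" "\<And>x. dist x t < e \<Longrightarrow> c < f x \<bullet> (v - u x)"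
    unfolding eventually_nhds_metric by blast
  define d where "d = Min {e, t, T - t} / 2"
  have d: "d > 0" "d < e" "d < t" "d < T - t"
    using e(1) t by (auto simp: d_def min_def)
  define w where "w x = (if x \<le> t - d then u x else if x \<le> t + d then v else u x)" for x
  have w: "w \<in> PC (cball 0 1)"
    unfolding w_def using u v by (intro PC_splice PC_const) auto
  \<comment> \<open>Only the right half of the spike is used for the lower bound: at the left endpoint
    \<open>t - d\<close> the control w still equals u.\<close>
  have "((\<lambda>_. c) has_integral d * c) (cbox t (t + d))"
    using has_integral_const_real[of c t "t + d"] d by simp
  from has_integral_restrict_closed_subinterval[OF this, of 0 T]
  have "((\<lambda>x. if x \<in> {t..t + d} then c else 0) has_integral d * c) {0..T}"
    using d t by simp
  moreover have "((\<lambda>x. f x \<bullet> (w x - u x)) has_integral integral {0..T} (\<lambda>t. f t \<bullet> (w t - u t))) {0..T}"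
    using int[OF w] by (rule integrable_integral)
  moreover have "(if x \<in> {t..t + d} then c else 0) \<le> f x \<bullet> (w x - u x)" for x
    using e(2)[of x] d c(1) by (auto simp: w_def dist_real_def)
  ultimately have "d * c \<le> integral {0..T} (\<lambda>t. f t \<bullet> (w t - u t))"
    by (rule has_integral_le)
  with le[OF w] d(1) c(1) show False
    using mult_pos_pos[of d c] by linarith
qed

text \<open>The Pontryagin maximum principle for the time optimal problem, with the switching function
  \<open>f(t) = B\<^sup>T exp(- t A)\<^sup>T z\<close>. By optimality \<open>- x0\<close> is not in the reachable sets for
  times before T, so a limit of separating functionals z supports the set for time T at
  \<open>- x0\<close>. As z lies in the span R of the reachable sets, it is not orthogonal to all of them,
  so f does not vanish identically, even when (A, B) is not controllable.\<close>

lemma maximum_principle: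
  fixes A :: "real^'n^'n" and B :: "real^'m^'n"
  assumes T: "0 < T" "T = optimal_time A B x0" and u: "u \<in> PC (cball 0 1)" "reaches_zero_at A B x0 u T"
  obtains f where "continuous_on UNIV f"
    and "\<And>a b v t. a < b \<Longrightarrow> (\<And>t. t \<in> {a<..<b} \<Longrightarrow> f t \<bullet> v = 0) \<Longrightarrow> f t \<bullet> v = 0"
    and "\<exists>t. f t \<noteq> 0"
    and "\<And>t v. 0 < t \<Longrightarrow> t < T \<Longrightarrow> isCont u t \<Longrightarrow> norm v \<le> 1 \<Longrightarrow> f t \<bullet> v \<le> f t \<bullet> u t"
proof -
  have uT: "integral {0..T} (pullback A B u) = - x0"
    using T(1) u by (intro reaches_zero_at_imp_integral) auto
  have out: "- x0 \<notin> reach A B s" if "0 < s" "s < T" for s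
  proof
    assume "- x0 \<in> reach A B s"
    then obtain w where w: "w \<in> PC (cball 0 1)" "reaches_zero_at A B x0 w s"
      by (auto simp: reach_def dest: sym intro: integral_imp_reaches_zero_at)
    have "T \<le> s"
      unfolding T(2) optimal_time_def using w that by (intro cInf_lower bdd_belowI[of _ 0]) auto
    with that show False by simp
  qed
  define R where "R = span (\<Union>s\<in>{0<..T}. reach A B s)"
  have sub: "reach A B s \<subseteq> R" if "0 < s" "s \<le> T" for s
    unfolding R_def using that by (intro subsetI span_base UN_I) auto
  obtain z where z: "z \<in> R" "z \<noteq> 0"
    "\<And>k l. (\<And>s. 0 < s \<Longrightarrow> s < T \<Longrightarrow> k s \<in> reach A B s) \<Longrightarrow> (k \<longlongrightarrow> l) (at_left T) \<Longrightarrow> z \<bullet> l \<le> z \<bullet> - x0"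
  proof (rule limit_separation[OF T(1), of "reach A B" "- x0" R])
    show "- x0 \<in> R"
      using sub[of T] T(1) u(1) uT by (force simp: reach_def)
    show "reach A B s \<noteq> {}" for s
      using u(1) by (auto simp: reach_def)
  qed (use sub out convex_reach in \<open>auto simp: R_def\<close>)
  \<comment> \<open>Stopping a control at s < T gives points of the earlier sets that converge to the point
    for time T.\<close>
  have le: "z \<bullet> integral {0..T} (pullback A B w) \<le> z \<bullet> - x0" if w: "w \<in> PC (cball 0 1)" for w
  proof (rule z(3))
    show "integral {0..s} (pullback A B w) \<in> reach A B s" for s
      using w by (auto simp: reach_def)
    have "continuous_on {0..T} (\<lambda>s. integral {0..s} (pullback A B w))"
      by (intro indefinite_integral_continuous_1 pullback_integrable w)
    then have "((\<lambda>s. integral {0..s} (pullback A B w)) \<longlongrightarrow> integral {0..T} (pullback A B w)) (at T within {0..T})"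
      using T(1) by (auto simp: continuous_on)
    then show "((\<lambda>s. integral {0..s} (pullback A B w)) \<longlongrightarrow> integral {0..T} (pullback A B w)) (at_left T)"
      using T(1) by (simp add: at_within_Icc_at_left)
  qed
  define f where "f t = transpose (mexp A (- t) ** B) *v z" for t
  have f: "f t \<bullet> v = z \<bullet> (mexp A (- t) *v (B *v v))" for t v
    by (simp add: f_def matrix_vector_mul_assoc dot_lmul_matrix[symmetric])
  have fpull: "f t \<bullet> w t = z \<bullet> pullback A B w t" for t w
    by (simp add: f pullback_def)
  have inner: "((\<lambda>t. z \<bullet> g t) has_integral z \<bullet> integral {0..s} g) {0..s}" if "g integrable_on {0..s}" for g s
    using has_integral_linear[OF integrable_integral[OF that] bounded_linear_inner_right, of z]
    by (simp add: o_def)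
  have cont: "continuous_on UNIV f"
    unfolding f_def transpose_def
    by (intro bounded_bilinear.continuous_on[OF bounded_bilinear_matrix_vector_mult]
        bounded_bilinear.continuous_on[OF bounded_bilinear_matrix_mult] continuous_intros)
  show thesis
  proof
    show "continuous_on UNIV f" by fact
    show "f t \<bullet> v = 0" if "a < b" and zero: "\<And>t. t \<in> {a<..<b} \<Longrightarrow> f t \<bullet> v = 0" for a b v t
      unfolding f
    proof (rule mexp_apply_analytic)
      show "- b < - a" using \<open>a < b\<close> by simp
      show "z \<bullet> (mexp A s *v (B *v v)) = 0" if "s \<in> {- b<..<- a}" for s
        using zero[of "- s"] that by (simp add: f)
    qed
    show "f t \<bullet> v \<le> f t \<bullet> u t" if t: "0 < t" "t < T" "isCont u t" and v: "norm v \<le> 1" for t v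
    proof (rule spike_maximality[OF u(1) _ _ _ t v])
      show "isCont f t" for t
        using cont by (simp add: continuous_on_eq_continuous_at)
      have hi: "((\<lambda>t. f t \<bullet> (w t - u t)) has_integral
          z \<bullet> (integral {0..T} (pullback A B w) - integral {0..T} (pullback A B u))) {0..T}"
        if "w \<in> PC (cball 0 1)" for w
        unfolding inner_diff_right fpull
        using that u(1) by (intro has_integral_diff inner pullback_integrable)
      then show "(\<lambda>t. f t \<bullet> (w t - u t)) integrable_on {0..T}" if "w \<in> PC (cball 0 1)" for w
        using that by blast
      show "integral {0..T} (\<lambda>t. f t \<bullet> (w t - u t)) \<le> 0" if "w \<in> PC (cball 0 1)" for w
        using integral_unique[OF hi[OF that]] le[OF that] uT
          by (simp add: inner_diff_right inner_add_right)
    qed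
    show "\<exists>t. f t \<noteq> 0"
    proof (rule ccontr)
      assume "\<not> (\<exists>t. f t \<noteq> 0)"
      then have zero: "z \<bullet> pullback A B w t = 0" for w t
        by (simp add: fpull[symmetric])
      have "z \<bullet> x = 0" if x: "x \<in> (\<Union>s\<in>{0<..T}. reach A B s)" for x
      proof -
        obtain s w where w: "w \<in> PC (cball 0 1)" and eq: "x = integral {0..s} (pullback A B w)"
          using x by (auto simp: reach_def)
        have "((\<lambda>t. z \<bullet> pullback A B w t) has_integral z \<bullet> x) {0..s}"
          unfolding eq by (intro inner pullback_integrable w)
        then show ?thesis
          by (simp add: zero)
      qed
      then have "z \<bullet> z = 0"
        using z(1) unfolding R_def
        by (metis (no_types, lifting) inner_commute orthogonal_def orthogonal_to_span)
      with z(2) show False by simp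
    qed
  qed
qed

section \<open>From the switching function to the control\<close>

text \<open>Left continuity carries a closed condition from a dense set of times to all times.\<close>

lemma left_limit_of_dense:
  fixes u :: "real \<Rightarrow> 'a::topological_space"
  assumes "(u \<longlongrightarrow> u t) (at_left t)" "closed E" "0 < t"
    and dense: "\<And>a. 0 \<le> a \<Longrightarrow> a < t \<Longrightarrow> \<exists>s\<in>{a<..<t}. u s \<in> E"
  shows "u t \<in> E"
proof (rule ccontr)
  assume "u t \<notin> E"
  then have "\<forall>\<^sub>F s in at_left t. u s \<in> - E"
    using assms(1,2) by (intro topological_tendstoD) auto
  then obtain b where "b < t" "\<And>s. b < s \<Longrightarrow> s < t \<Longrightarrow> u s \<notin> E"
    by (auto simp: eventually_at_left_field)
  with dense[of "max b 0"] \<open>0 < t\<close> show False by auto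
qed

text \<open>The equality case of the Cauchy-Schwarz inequality: on the unit ball the functional
  \<open>v \<mapsto> f \<bullet> v\<close> attains its maximum \<open>|f|\<close> at the normalisation of f only.\<close>

lemma eq_normalized_if_maximal:
  fixes f y :: "'a::real_inner"
  assumes "norm y \<le> 1" "f \<noteq> 0" "\<And>v. norm v \<le> 1 \<Longrightarrow> f \<bullet> v \<le> f \<bullet> y"
  shows "y = f /\<^sub>R norm f"
proof -
  have "f \<bullet> (f /\<^sub>R norm f) \<le> f \<bullet> y"
    by (rule assms(3)) (use assms(2) in auto)
  then have ge: "norm f \<le> f \<bullet> y"
    using assms(2) by (simp add: dot_square_norm power2_eq_square field_simps)
  moreover have "f \<bullet> y \<le> norm f * norm y" "norm f * norm y \<le> norm f * 1"
    by (auto simp: assms(1) norm_cauchy_schwarz intro!: mult_left_mono simp del: mult_1_right)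
  ultimately have "norm f * norm y = norm f * 1" "f \<bullet> y = norm f * norm y"
    by linarith+
  then have "f \<bullet> y = norm f * norm y" "norm y = 1"
    using assms(2) by auto
  then have "norm f *\<^sub>R y = f"
    using norm_cauchy_schwarz_eq[of f y] by simp
  then have "f /\<^sub>R norm f = (norm f *\<^sub>R y) /\<^sub>R norm f"
    by simp
  then show ?thesis
    using assms(2) by simp
qed

text \<open>Wherever the switching function f is not zero and u is continuous, u is \<open>f / |f|\<close>; such
  times are dense because f vanishes on no interval. Left continuity then puts u on the unit
  sphere at all times. If u keeps the direction v on some interval, then f is a multiple of v
  there, hence on the whole line by the identity property of f, and so u is v or - v at all
  times.\<close>

lemma bang_bang_dichotomy:
  fixes f :: "real \<Rightarrow> 'a::euclidean_space"
  assumes u: "u \<in> PC (cball 0 1)"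
    and cont: "continuous_on UNIV f"
    and unique: "\<And>a b v t. a < b \<Longrightarrow> (\<And>t. t \<in> {a<..<b} \<Longrightarrow> f t \<bullet> v = 0) \<Longrightarrow> f t \<bullet> v = 0"
    and nz: "\<exists>t. f t \<noteq> 0"
    and max: "\<And>t v. 0 < t \<Longrightarrow> t < T \<Longrightarrow> isCont u t \<Longrightarrow> norm v \<le> 1 \<Longrightarrow> f t \<bullet> v \<le> f t \<bullet> u t"
  shows "u ` {0<..<T} \<subseteq> sphere 0 1"
    and "never_one_direction T u \<or> (\<exists>v\<in>sphere 0 1. u ` {0<..<T} \<subseteq> {v, - v})"
proof -
  have good: "\<exists>s\<in>{a<..<b}. f s \<noteq> 0 \<and> u s = f s /\<^sub>R norm (f s)" if ab: "0 \<le> a" "a < b" "b \<le> T" for a b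
  proof -
    obtain t0 where "f t0 \<noteq> 0" using nz by blast
    then obtain t where t: "t \<in> {a<..<b}" "f t \<noteq> 0"
      using unique[OF ab(2), of "f t0" t0] by force
    have "open ({a<..<b} \<inter> {t. f t \<noteq> 0})"
      using cont by (intro open_Int open_Collect_neq) auto
    then have "infinite ({a<..<b} \<inter> {t. f t \<noteq> 0})"
      using t finite_imp_not_open by blast
    then have "\<not> {a<..<b} \<inter> {t. f t \<noteq> 0} \<subseteq> {t. t > 0 \<and> \<not> isCont u t}"
      using PC_finite_discontinuities[OF u] finite_subset by blast
    then obtain s where s: "s \<in> {a<..<b}" "f s \<noteq> 0" "isCont u s"
      using ab by fastforce
    then have "u s = f s /\<^sub>R norm (f s)"
      using ab PC_in[OF u, of s] by (intro eq_normalized_if_maximal max) auto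
    with s show ?thesis by blast
  qed
  have sphere: "u t \<in> sphere 0 1" if "t \<in> {0<..<T}" for t
  proof (rule left_limit_of_dense[OF PC_left_continuous[OF u]])
    show "\<exists>s\<in>{a<..<t}. u s \<in> sphere 0 1" if a: "0 \<le> a" "a < t" for a
    proof -
      obtain s where "s \<in> {a<..<t}" "f s \<noteq> 0" "u s = f s /\<^sub>R norm (f s)"
        using good[of a t] a \<open>t \<in> {0<..<T}\<close> by auto
      then show ?thesis by (intro bexI[of _ s]) auto
    qed
  qed (use that in auto)
  then show "u ` {0<..<T} \<subseteq> sphere 0 1" by blast
  show "never_one_direction T u \<or> (\<exists>v\<in>sphere 0 1. u ` {0<..<T} \<subseteq> {v, - v})"
  proof (rule disjCI)
    assume "\<not> (\<exists>v\<in>sphere 0 1. u ` {0<..<T} \<subseteq> {v, - v})"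
    show "never_one_direction T u"
      unfolding never_one_direction_def
    proof (intro allI impI notI)
      fix a b assume ab: "0 \<le> a \<and> a < b \<and> b \<le> T" and "one_direction_on {a<..<b} u"
      then obtain v where v: "norm v = 1" and ray: "\<And>t. t \<in> {a<..<b} \<Longrightarrow> \<exists>r\<ge>0. u t = r *\<^sub>R v"
        by (auto simp: one_direction_on_def)
      have uv: "u t = v" if t: "t \<in> {a<..<b}" for t
      proof -
        obtain r where "r \<ge> 0" "u t = r *\<^sub>R v" using ray[OF t] by blast
        moreover have "norm (u t) = 1" using sphere[of t] t ab by auto
        ultimately show ?thesis using v by simp
      qed
      \<comment> \<open>Apply the identity property to the functions \<open>f t \<bullet> w\<close> with w orthogonal to v.\<close>
      have par: "f t = (f t \<bullet> v) *\<^sub>R v" for t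
      proof -
        have perp: "f t \<bullet> w = 0" if "v \<bullet> w = 0" for w t
        proof (rule unique)
          show "a < b" using ab by simp
          fix s assume s: "s \<in> {a<..<b}"
          \<comment> \<open>As u is constant near s, it is continuous there, so s is no exceptional time.\<close>
          have "\<forall>\<^sub>F x in nhds s. u x = v"
            using uv s by (intro eventually_nhds_in_open[THEN eventually_mono, of "{a<..<b}"]) auto
          then have "isCont u s"
            by (subst isCont_cong) auto
          then have "f s \<noteq> 0 \<Longrightarrow> u s = f s /\<^sub>R norm (f s)"
            using s ab PC_in[OF u, of s] by (intro eq_normalized_if_maximal max) auto
          then have "f s = norm (f s) *\<^sub>R v"
            using uv[OF s] by (cases "f s = 0") auto
          then have "f s \<bullet> w = norm (f s) * (v \<bullet> w)"
            by (metis inner_scaleR_left)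
          with that show "f s \<bullet> w = 0" by simp
        qed
        define w where "w = f t - (f t \<bullet> v) *\<^sub>R v"
        have "v \<bullet> w = 0"
          using v by (simp add: w_def inner_diff_right inner_commute dot_square_norm)
        moreover from perp[OF this, of t] this have "w \<bullet> w = 0"
          by (simp add: w_def inner_diff_left)
        ultimately show ?thesis by (simp add: w_def)
      qed
      have "u t \<in> {v, - v}" if "t \<in> {0<..<T}" for t
      proof (rule left_limit_of_dense[OF PC_left_continuous[OF u]])
        fix c assume "0 \<le> c" "c < t"
        then obtain s where s: "s \<in> {c<..<t}" "f s \<noteq> 0" "u s = f s /\<^sub>R norm (f s)"
          using good[of c t] \<open>t \<in> {0<..<T}\<close> by auto
        define g where "g = f s \<bullet> v"
        have "f s = g *\<^sub>R v" unfolding g_def by (rule par)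
        then have "u s = sgn g *\<^sub>R v" "g \<noteq> 0"
          using s v by (auto simp: sgn_real_def)
        then have "u s \<in> {v, - v}" by (auto simp: sgn_real_def)
        with s(1) show "\<exists>s\<in>{c<..<t}. u s \<in> {v, - v}" by blast
      qed (use that in auto)
      then have "u ` {0<..<T} \<subseteq> {v, - v}" by blast
      moreover have "v \<in> sphere 0 1" using v by simp
      ultimately show False
        using \<open>\<not> (\<exists>v\<in>sphere 0 1. u ` {0<..<T} \<subseteq> {v, - v})\<close> by blast
    qed
  qed
qed

section \<open>The four behaviours\<close>

text \<open>The complement of finitely many switching times contains an interval, and there the control
  is constant.\<close>

lemma behaviour_A3_not_never_one_direction:
  assumes "0 < T" "behaviour_A3 T u"
  shows "\<not> never_one_direction T u"
proof
  assume never: "never_one_direction T u"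
  obtain v D where v: "v \<in> sphere 0 1" "u ` {0<..<T} = {v, - v}"
    and D: "finite D" "\<And>a b. {a<..<b} \<subseteq> {0<..<T} - D \<Longrightarrow> u constant_on {a<..<b}"
    using assms(2) by (auto simp: behaviour_A3_def step_function_on_def)
  have "open ({0<..<T} - D)"
    using D(1) by (intro open_Diff finite_imp_closed) auto
  moreover have "infinite ({0<..<T} - D)"
    using D(1) assms(1) by (intro Diff_infinite_finite infinite_Ioo)
  then obtain x where x: "x \<in> {0<..<T} - D"
    using infinite_imp_nonempty by blast
  ultimately obtain e where "e > 0" "ball x e \<subseteq> {0<..<T} - D"
    by (rule openE)
  then have e: "e > 0" "{x - e<..<x + e} \<subseteq> {0<..<T} - D"
    by (simp_all add: ball_eq_greaterThanLessThan)
  then have bounds: "0 \<le> x - e" "x - e < x + e" "x + e \<le> T"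
    using greaterThanLessThan_subseteq_greaterThanLessThan[of "x - e" "x + e" 0 T] by auto
  obtain c where c: "\<And>t. t \<in> {x - e<..<x + e} \<Longrightarrow> u t = c"
    using D(2)[OF e(2)] by (auto simp: constant_on_def)
  have "u x = c" "u x \<in> u ` {0<..<T}"
    using c[of x] e x by auto
  then have "c \<in> sphere 0 1"
    unfolding v(2) using v(1) by auto
  then have "one_direction_on {x - e<..<x + e} u"
    unfolding one_direction_on_def using c by (intro bexI[of _ c] ballI exI[of _ 1]) auto
  with never bounds show False
    unfolding never_one_direction_def by blast
qed

lemma behaviour_A1_not_never_one_direction:
  assumes "0 < T" "behaviour_A1 T u"
  shows "\<not> never_one_direction T u"
proof -
  obtain v where "v \<in> sphere 0 1" "\<forall>t\<in>{0<..<T}. u t = v"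
    using assms(2) by (auto simp: behaviour_A1_def)
  then have "one_direction_on {0<..<T} u"
    unfolding one_direction_on_def by (intro bexI[of _ v] ballI exI[of _ 1]) auto
  with assms(1) show ?thesis
    unfolding never_one_direction_def by blast
qed

lemma behaviours_exclusive:
  assumes "0 < T"
  shows "\<not> (behaviour_A1 T u \<and> behaviour_A2 T u)" "\<not> (behaviour_A1 T u \<and> behaviour_A3 T u)"
    "\<not> (behaviour_A1 T u \<and> behaviour_A4 T u)" "\<not> (behaviour_A2 T u \<and> behaviour_A3 T u)"
    "\<not> (behaviour_A2 T u \<and> behaviour_A4 T u)" "\<not> (behaviour_A3 T u \<and> behaviour_A4 T u)"
proof -
  have "u constant_on {0<..<T}" if "behaviour_A1 T u"
    using that by (auto simp: behaviour_A1_def constant_on_def)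
  moreover have "\<not> u constant_on {0<..<T}" if "behaviour_A3 T u"
    using that by (simp add: behaviour_A3_def)
  moreover have "continuous_on {0<..<T} u" "never_one_direction T u" if "behaviour_A2 T u"
    using that by (simp_all add: behaviour_A2_def)
  moreover have "\<not> continuous_on {0<..<T} u" "never_one_direction T u" if "behaviour_A4 T u"
    using that by (simp_all add: behaviour_A4_def)
  ultimately show "\<not> (behaviour_A1 T u \<and> behaviour_A2 T u)" "\<not> (behaviour_A1 T u \<and> behaviour_A3 T u)"
    "\<not> (behaviour_A1 T u \<and> behaviour_A4 T u)" "\<not> (behaviour_A2 T u \<and> behaviour_A3 T u)"
    "\<not> (behaviour_A2 T u \<and> behaviour_A4 T u)" "\<not> (behaviour_A3 T u \<and> behaviour_A4 T u)"
    using behaviour_A1_not_never_one_direction[OF assms] behaviour_A3_not_never_one_direction[OF assms]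
    by blast+
qed

text \<open>Between two consecutive discontinuities the control is a continuous map into a two-point
  set, hence constant; so it is a step function.\<close>

lemma behaviour_A1_or_A3:
  assumes "0 < T" and u: "u \<in> PC E" and v: "v \<in> sphere 0 1" and sub: "u ` {0<..<T} \<subseteq> {v, - v}"
  shows "behaviour_A1 T u \<or> behaviour_A3 T u"
proof (cases "u constant_on {0<..<T}")
  case True
  then obtain c where c: "\<And>t. t \<in> {0<..<T} \<Longrightarrow> u t = c"
    by (auto simp: constant_on_def)
  moreover have "u (T / 2) \<in> {v, - v}"
    by (rule subsetD[OF sub imageI]) (use \<open>0 < T\<close> in auto)
  ultimately have "c \<in> sphere 0 1"
    using v \<open>0 < T\<close> by auto
  then show ?thesis
    using c unfolding behaviour_A1_def by blast
next
  case False
  let ?D = "{t. t > 0 \<and> \<not> isCont u t}"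
  have "u constant_on {a<..<b}" if ab: "{a<..<b} \<subseteq> {0<..<T} - ?D" for a b
  proof -
    have "connected (u ` {a<..<b})"
      using ab by (intro connected_continuous_image continuous_at_imp_continuous_on) auto
    moreover have "u ` {a<..<b} \<subseteq> {v, - v}"
      using ab sub by blast
    then have "finite (u ` {a<..<b})"
      by (rule finite_subset) simp
    ultimately show ?thesis
      by (auto simp: connected_finite_iff_sing constant_on_def)
  qed
  then have "step_function_on {0<..<T} u"
    unfolding step_function_on_def using PC_finite_discontinuities[OF u] by blast
  moreover have "u ` {0<..<T} = {v, - v}"
  proof -
    have pm: "u t = v \<or> u t = - v" if "t \<in> {0<..<T}" for t
      using subsetD[OF sub imageI[OF that]] by simp
    have "\<exists>t\<in>{0<..<T}. u t = v" "\<exists>t\<in>{0<..<T}. u t = - v"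
      using False pm unfolding constant_on_def by metis+
    then have "v \<in> u ` {0<..<T}" "- v \<in> u ` {0<..<T}"
      by (metis imageI)+
    with sub show ?thesis by (intro subset_antisym) simp_all
  qed
  ultimately show ?thesis
    using False v unfolding behaviour_A3_def by blast
qed

lemma behaviour_A2_or_A4:
  assumes "u \<in> PC E" "u ` {0<..<T} \<subseteq> sphere 0 1" "never_one_direction T u"
  shows "behaviour_A2 T u \<or> behaviour_A4 T u"
proof (cases "continuous_on {0<..<T} u")
  case True
  with assms show ?thesis by (simp add: behaviour_A2_def)
next
  case False
  then have "\<not> u constant_on {0<..<T}"
    by (metis (no_types, lifting) constant_on_def continuous_on_const continuous_on_cong)
  moreover have "piecewise_continuous_on {0<..<T} u"
    using assms(1) PC_finite_discontinuities[OF assms(1)]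
    unfolding PC_def piecewise_continuous_on_def by (auto elim: rev_finite_subset)
  ultimately show ?thesis
    using False assms(3) by (simp add: behaviour_A4_def)
qed

lemma optimal_time_pos:
  assumes "x0 \<noteq> 0" "\<exists>w. admissible_control A B x0 w" "optimal_control A B x0 u"
  shows "0 < optimal_time A B x0"
proof -
  have "0 \<le> optimal_time A B x0"
    unfolding optimal_time_def using assms(2)
    by (intro cInf_greatest) (auto simp: admissible_control_def)
  moreover have "optimal_time A B x0 \<noteq> 0"
    using assms(1,3) by (auto simp: optimal_control_def reaches_zero_at_def state_solution_def)
  ultimately show ?thesis by simp
qed

theorem theorem1p4:
  fixes A :: "real^'n^'n" and B :: "real^'m^'n" and x0 :: "real^'n"
    and T :: real and u :: "real \<Rightarrow> real^'m"
  assumes "B \<noteq> 0" and "x0 \<noteq> 0"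
    and "\<exists>w. admissible_control A B x0 w"
    and "T = optimal_time A B x0"
    and "optimal_control A B x0 u"
  shows "(behaviour_A1 T u \<or> behaviour_A2 T u \<or> behaviour_A3 T u \<or> behaviour_A4 T u) \<and>
    \<not> (behaviour_A1 T u \<and> behaviour_A2 T u) \<and>
    \<not> (behaviour_A1 T u \<and> behaviour_A3 T u) \<and>
    \<not> (behaviour_A1 T u \<and> behaviour_A4 T u) \<and>
    \<not> (behaviour_A2 T u \<and> behaviour_A3 T u) \<and>
    \<not> (behaviour_A2 T u \<and> behaviour_A4 T u) \<and>
    \<not> (behaviour_A3 T u \<and> behaviour_A4 T u)"
proof -
  have T: "0 < T"
    unfolding assms(4) using assms(2,3,5) by (rule optimal_time_pos)
  have u: "u \<in> PC (cball 0 1)" and zero: "reaches_zero_at A B x0 u T"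
    using assms(4,5) by (simp_all add: optimal_control_def)
  obtain f where f: "continuous_on UNIV f"
    "\<And>a b v t. a < b \<Longrightarrow> (\<And>t. t \<in> {a<..<b} \<Longrightarrow> f t \<bullet> v = 0) \<Longrightarrow> f t \<bullet> v = 0"
    "\<exists>t. f t \<noteq> 0"
    "\<And>t v. 0 < t \<Longrightarrow> t < T \<Longrightarrow> isCont u t \<Longrightarrow> norm v \<le> 1 \<Longrightarrow> f t \<bullet> v \<le> f t \<bullet> u t"
    using maximum_principle[OF T assms(4) u zero] by blast
  have "u ` {0<..<T} \<subseteq> sphere 0 1"
    by (rule bang_bang_dichotomy(1)[OF u f(1)]; fact f)
  moreover have "never_one_direction T u \<or> (\<exists>v\<in>sphere 0 1. u ` {0<..<T} \<subseteq> {v, - v})"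
    by (rule bang_bang_dichotomy(2)[OF u f(1)]; fact f)
  ultimately have "behaviour_A1 T u \<or> behaviour_A2 T u \<or> behaviour_A3 T u \<or> behaviour_A4 T u"
    using behaviour_A1_or_A3[OF T u] behaviour_A2_or_A4[OF u] by blast
  then show ?thesis
    using behaviours_exclusive[OF T, of u] by simp
qed

end
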